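(* Assume that $\mathcal{D}$ and $S_{\mathcal{D}}(f)$ are both convex and have nonempty interior. (i) If $f(x)$ and every $g_i(x)$ ($1\le i\le m$) are q-module concave over $\mathcal{D}$, then $S_{\mathcal{D}}(f)=\mathcal{L}_{qmod}^{\mathcal{D}}(f)$. (ii) If $f(x)$ and every $g_i(x)$ ($1\le i\le m$) are preordering concave over $\mathcal{D}$, then $S_{\mathcal{D}}(f)=\mathcal{L}_{pre}^{\mathcal{D}}(f)$. (Equality means that $S_{\mathcal{D}}(f)$ equals the image of the lifted set under the projection $\rho$ defined in the context.)
   Context: Let $f,g_1,\dots,g_m\in\mathbb{R}[x]$, $x=(x_1,\dots,x_n)$, $g_0:=1$, $\mathcal{D}=\{x\in\mathbb{R}^n: g_1(x)\ge0,\dots,g_m(x)\ge0\}$, and $S_{\mathcal{D}}(f)=\{x\in\mathcal{D}: f(x)\ge0\}$. A polynomial is sos if it is a finite sum of squares of polynomials. For a polynomial $h$ let $R_h(x,u)=h(x)-h(u)-\nabla h(u)^T(x-u)$. $h$ is q-module convex over $\mathcal{D}$ (with respect to the given $g_i$) if $R_h(x,u)=\sum_{i=0}^m g_i(x)\big(\sum_{j=0}^m g_j(u)\sigma_{ij}(x,u)\big)$ for some sos polynomials $\sigma_{ij}(x,u)$. $h$ is preordering convex over $\mathcal{D}$ if $R_h(x,u)=\sum_{\nu\in\{0,1\}^m} g_1^{\nu_1}(x)\cdots g_m^{\nu_m}(x)\big(\sum_{\mu\in\{0,1\}^m} g_1^{\mu_1}(u)\cdots g_m^{\mu_m}(u)\sigma_{\nu,\mu}(x,u)\big)$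 for some sos polynomials $\sigma_{\nu,\mu}(x,u)$. $h$ is q-module (resp. preordering) concave over $\mathcal{D}$ if $-h$ is q-module (resp. preordering) convex over $\mathcal{D}$. In case (i), for each $h\in\{f,g_1,\dots,g_m\}$ fix sos polynomials $\sigma^h_{ij}$ giving such a representation of $-R_h$ and set $d=d^{(P)}_{qmod}:=\max_h\max_{i,j}\lceil\frac12\deg_x(g_i\sigma^h_{ij})\rceil$. In case (ii), fix sos polynomials $\sigma^h_{\nu,\mu}$ giving such a representation of $-R_h$ and set $d=d^{(P)}_{pre}:=\max_h\max_{\nu,\mu}\lceil\frac12\deg_x(g_1^{\nu_1}\cdots g_m^{\nu_m}\sigma^h_{\nu,\mu})\rceil$. Here $\deg_x$ is the degree in $x$. Convention: $d\ge1$ (replace $d$ by $1$ if the formula gives less), and $\deg f\le 2d$. Let $d_i=\lceil\frac12\deg g_i\rceil$, $d_\nu=\lceil\frac12\deg(g_1^{\nu_1}\cdots g_m^{\nu_m})\rceil$, and let $\mathfrak{m}_k(x)$ be the column vector of all monomials in $x$ of degree $\le k$ (empty if $k<0$, in which case the corresponding matrix constraint below is void). Define symmetric matrices $G^{(i)}_\alpha,G^{(\nu)}_\alpha$ by $g_i(x)\mathfrak{m}_{d-d_i}(x)\mathfrak{m}_{d-d_i}(x)^T=\sum_{|\alpha|\le2d}G^{(i)}_\alpha x^\alpha$ and $g_1^{\nu_1}(x)\cdots g_m^{\nu_m}(x)\mathfrak{m}_{d-d_\nu}(x)\mathfrak{m}_{d-d_\nu}(x)^T=\sum_{|\alpha|\le2d}G^{(\nu)}_\alpha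 x^\alpha$. For a real vector $y=(y_\alpha)_{\alpha\in\mathbb{N}^n,|\alpha|\le2d}$ let $N_i(y)=\sum_\alpha G^{(i)}_\alpha y_\alpha$ ($0\le i\le m$), $N_\nu(y)=\sum_\alpha G^{(\nu)}_\alpha y_\alpha$ ($\nu\in\{0,1\}^m$), and, writing $f(x)=\sum_{|\alpha|\le2d}f_\alpha x^\alpha$, let $f^Ty=\sum_\alpha f_\alpha y_\alpha$. Define $\mathcal{L}_{qmod}^{\mathcal{D}}(f)=\{y: y_0=1,\ f^Ty\ge0,\ N_i(y)\succeq0,\ 0\le i\le m\}$ and $\mathcal{L}_{pre}^{\mathcal{D}}(f)=\{y: y_0=1,\ f^Ty\ge0,\ N_\nu(y)\succeq0,\ \nu\in\{0,1\}^m\}$. The projection is $\rho(y)=(y_{e_1},\dots,y_{e_n})$, with $e_i$ the $i$-th unit vector of $\mathbb{N}^n$. *)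

theory Defs
  imports "HOL-Analysis.Analysis" "HOL-Library.Poly_Mapping" "HOL-Library.FuncSet"
begin

section \<open>Real multivariate polynomials\<close>

text \<open>
  An exponent vector over the variables \<open>'v\<close> is a finitely supported map into \<open>nat\<close>; a polynomial
  is a finitely supported map from exponent vectors to its coefficients, and the product of the
  library's ring structure is the convolution product. \<open>\<real>[x]\<close> with \<open>x = (x\<^sub>1,\<dots>,x\<^sub>n)\<close> is
  \<open>'n mpoly\<close> with \<open>n = CARD('n)\<close>; \<open>\<real>[x,u]\<close> is \<open>('n + 'n) mpoly\<close>, with \<open>Inl i\<close> standing for
  \<open>x\<^sub>i\<close> and \<open>Inr i\<close> for \<open>u\<^sub>i\<close>.
\<close>

type_synonym 'v expo = "'v \<Rightarrow>\<^sub>0 nat"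
type_synonym 'v mpoly = "'v expo \<Rightarrow>\<^sub>0 real"

definition coef :: "'v mpoly \<Rightarrow> 'v expo \<Rightarrow> real" where
  "coef p \<alpha> = Poly_Mapping.lookup p \<alpha>"

definition monomial :: "'v expo \<Rightarrow> 'v mpoly" where
  "monomial \<alpha> = Poly_Mapping.single \<alpha> 1"

definition Const :: "real \<Rightarrow> 'v mpoly" where
  "Const c = Poly_Mapping.single 0 c"

definition Var :: "'v \<Rightarrow> 'v mpoly" where
  "Var i = monomial (Poly_Mapping.single i 1)"

definition subst :: "('v \<Rightarrow> 'w mpoly) \<Rightarrow> 'v mpoly \<Rightarrow> 'w mpoly" where
  "subst s p = (\<Sum>\<alpha>\<in>Poly_Mapping.keys p.
     Const (coef p \<alpha>) * (\<Prod>i\<in>Poly_Mapping.keys \<alpha>. s i ^ Poly_Mapping.lookup \<alpha> i))"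

definition evalp :: "'n::finite mpoly \<Rightarrow> real ^ 'n \<Rightarrow> real" where
  "evalp p x = (\<Sum>\<alpha>\<in>Poly_Mapping.keys p.
     coef p \<alpha> * (\<Prod>i\<in>UNIV. (x $ i) ^ Poly_Mapping.lookup \<alpha> i))"

text \<open>
  If \<open>i\<close> does not occur in \<open>\<alpha>\<close>, the (truncating) exponent subtraction is harmless, as the
  coefficient is then zero.
\<close>
definition partial :: "'v \<Rightarrow> 'v mpoly \<Rightarrow> 'v mpoly" where
  "partial i p = (\<Sum>\<alpha>\<in>Poly_Mapping.keys p.
     Poly_Mapping.single (\<alpha> - Poly_Mapping.single i 1) (real (Poly_Mapping.lookup \<alpha> i) * coef p \<alpha>))"

definition expo_degree :: "'n::finite expo \<Rightarrow> nat" where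
  "expo_degree \<alpha> = (\<Sum>i\<in>UNIV. Poly_Mapping.lookup \<alpha> i)"

text \<open>Degree with respect to the variables in \<open>V\<close>; the zero polynomial gets degree 0.\<close>
definition degree_in :: "'v set \<Rightarrow> 'v mpoly \<Rightarrow> nat" where
  "degree_in V p = Max (insert 0 ((\<lambda>\<alpha>. \<Sum>i\<in>V. Poly_Mapping.lookup \<alpha> i) ` Poly_Mapping.keys p))"

definition total_degree :: "'n::finite mpoly \<Rightarrow> nat" where
  "total_degree p = degree_in UNIV p"

definition degree_x :: "('n + 'n::finite) mpoly \<Rightarrow> nat" where
  "degree_x p = degree_in (Inl ` UNIV) p"

definition half_up :: "nat \<Rightarrow> nat" where
  "half_up k = nat \<lceil>real k / 2\<rceil>"

definition sos :: "'v mpoly \<Rightarrow> bool" where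
  "sos p \<longleftrightarrow> (\<exists>(k::nat) q. p = (\<Sum>l<k. (q l)\<^sup>2))"


section \<open>Q-module and preordering convexity\<close>

definition in_x :: "'n mpoly \<Rightarrow> ('n + 'n) mpoly" where
  "in_x p = subst (\<lambda>i. Var (Inl i)) p"

definition in_u :: "'n mpoly \<Rightarrow> ('n + 'n) mpoly" where
  "in_u p = subst (\<lambda>i. Var (Inr i)) p"

definition Rem :: "'n::finite mpoly \<Rightarrow> ('n + 'n) mpoly" where
  "Rem h = in_x h - in_u h - (\<Sum>i\<in>UNIV. in_u (partial i h) * (Var (Inl i) - Var (Inr i)))"

text \<open>
  The constraint polynomials are \<open>g 1, \<dots>, g m\<close>; the other values of \<open>g\<close> are irrelevant.
  \<open>gen g\<close> adds the convention \<open>g\<^sub>0 = 1\<close>.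
\<close>
definition gen :: "(nat \<Rightarrow> 'v mpoly) \<Rightarrow> nat \<Rightarrow> 'v mpoly" where
  "gen g i = (if i = 0 then 1 else g i)"

text \<open>\<open>{0,1}\<^sup>m\<close>, indexed by \<open>1..m\<close>.\<close>
definition cube :: "nat \<Rightarrow> (nat \<Rightarrow> nat) set" where
  "cube m = ({1..m} \<rightarrow>\<^sub>E {0,1})"

definition gprod :: "nat \<Rightarrow> (nat \<Rightarrow> 'v mpoly) \<Rightarrow> (nat \<Rightarrow> nat) \<Rightarrow> 'v mpoly" where
  "gprod m g \<nu> = (\<Prod>i=1..m. g i ^ \<nu> i)"

definition qmod_repr ::
  "nat \<Rightarrow> (nat \<Rightarrow> 'n mpoly) \<Rightarrow> ('n + 'n) mpoly \<Rightarrow> (nat \<Rightarrow> nat \<Rightarrow> ('n + 'n) mpoly) \<Rightarrow> bool" where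
  "qmod_repr m g r \<sigma> \<longleftrightarrow>
     (\<forall>i\<le>m. \<forall>j\<le>m. sos (\<sigma> i j)) \<and>
     r = (\<Sum>i\<le>m. in_x (gen g i) * (\<Sum>j\<le>m. in_u (gen g j) * \<sigma> i j))"

definition pre_repr ::
  "nat \<Rightarrow> (nat \<Rightarrow> 'n mpoly) \<Rightarrow> ('n + 'n) mpoly \<Rightarrow>
   ((nat \<Rightarrow> nat) \<Rightarrow> (nat \<Rightarrow> nat) \<Rightarrow> ('n + 'n) mpoly) \<Rightarrow> bool" where
  "pre_repr m g r \<sigma> \<longleftrightarrow>
     (\<forall>\<nu>\<in>cube m. \<forall>\<mu>\<in>cube m. sos (\<sigma> \<nu> \<mu>)) \<and>
     r = (\<Sum>\<nu>\<in>cube m. in_x (gprod m g \<nu>) * (\<Sum>\<mu>\<in>cube m. in_u (gprod m g \<mu>) * \<sigma> \<nu> \<mu>))"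

definition qmod_convex :: "nat \<Rightarrow> (nat \<Rightarrow> 'n::finite mpoly) \<Rightarrow> 'n mpoly \<Rightarrow> bool" where
  "qmod_convex m g h \<longleftrightarrow> (\<exists>\<sigma>. qmod_repr m g (Rem h) \<sigma>)"

definition pre_convex :: "nat \<Rightarrow> (nat \<Rightarrow> 'n::finite mpoly) \<Rightarrow> 'n mpoly \<Rightarrow> bool" where
  "pre_convex m g h \<longleftrightarrow> (\<exists>\<sigma>. pre_repr m g (Rem h) \<sigma>)"

definition qmod_concave :: "nat \<Rightarrow> (nat \<Rightarrow> 'n::finite mpoly) \<Rightarrow> 'n mpoly \<Rightarrow> bool" where
  "qmod_concave m g h \<longleftrightarrow> qmod_convex m g (- h)"

definition pre_concave :: "nat \<Rightarrow> (nat \<Rightarrow> 'n::finite mpoly) \<Rightarrow> 'n mpoly \<Rightarrow> bool" where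
  "pre_concave m g h \<longleftrightarrow> pre_convex m g (- h)"


section \<open>The sets and the relaxation orders\<close>

definition dom_set :: "nat \<Rightarrow> (nat \<Rightarrow> 'n::finite mpoly) \<Rightarrow> (real ^ 'n) set" where
  "dom_set m g = {x. \<forall>i\<in>{1..m}. evalp (g i) x \<ge> 0}"

definition sol_set :: "nat \<Rightarrow> (nat \<Rightarrow> 'n::finite mpoly) \<Rightarrow> 'n mpoly \<Rightarrow> (real ^ 'n) set" where
  "sol_set m g f = {x \<in> dom_set m g. evalp f x \<ge> 0}"

text \<open>\<open>\<sigma> h\<close> is the family of multipliers chosen for the polynomial \<open>h\<close>.\<close>
definition d_qmod ::
  "nat \<Rightarrow> (nat \<Rightarrow> 'n::finite mpoly) \<Rightarrow> 'n mpoly \<Rightarrow>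
   ('n mpoly \<Rightarrow> nat \<Rightarrow> nat \<Rightarrow> ('n + 'n) mpoly) \<Rightarrow> nat" where
  "d_qmod m g f \<sigma> = max 1 (Max {half_up (degree_x (in_x (gen g i) * \<sigma> h i j)) | h i j.
     h \<in> insert f (g ` {1..m}) \<and> i \<le> m \<and> j \<le> m})"

definition d_pre ::
  "nat \<Rightarrow> (nat \<Rightarrow> 'n::finite mpoly) \<Rightarrow> 'n mpoly \<Rightarrow>
   ('n mpoly \<Rightarrow> (nat \<Rightarrow> nat) \<Rightarrow> (nat \<Rightarrow> nat) \<Rightarrow> ('n + 'n) mpoly) \<Rightarrow> nat" where
  "d_pre m g f \<sigma> = max 1 (Max {half_up (degree_x (in_x (gprod m g \<nu>) * \<sigma> h \<nu> \<mu>)) | h \<nu> \<mu>.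
     h \<in> insert f (g ` {1..m}) \<and> \<nu> \<in> cube m \<and> \<mu> \<in> cube m})"


section \<open>Localizing matrices and the lifted sets\<close>

text \<open>
  Exponents of the monomials in \<open>\<mm>\<^sub>k\<close>. The bound is an integer because \<open>d - d\<^sub>\<nu>\<close> can be
  negative, and then there are no monomials. Matrices are indexed by these exponents.
\<close>
definition mons :: "int \<Rightarrow> 'n::finite expo set" where
  "mons k = {\<alpha>. int (expo_degree \<alpha>) \<le> k}"

text \<open>Entry \<open>(\<beta>, \<gamma>)\<close> of the matrix coefficient of \<open>x\<^sup>\<alpha>\<close> in \<open>p(x) \<mm>(x) \<mm>(x)\<^sup>T\<close>.\<close>
definition Gmat :: "'n mpoly \<Rightarrow> 'n expo \<Rightarrow> 'n expo \<Rightarrow> 'n expo \<Rightarrow> real" where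
  "Gmat p \<alpha> \<beta> \<gamma> = coef (p * monomial \<beta> * monomial \<gamma>) \<alpha>"

definition Nmat :: "nat \<Rightarrow> 'n::finite mpoly \<Rightarrow> ('n expo \<Rightarrow> real) \<Rightarrow> 'n expo \<Rightarrow> 'n expo \<Rightarrow> real" where
  "Nmat d p y \<beta> \<gamma> = (\<Sum>\<alpha>\<in>mons (2 * int d). Gmat p \<alpha> \<beta> \<gamma> * y \<alpha>)"

definition psd_on :: "'b set \<Rightarrow> ('b \<Rightarrow> 'b \<Rightarrow> real) \<Rightarrow> bool" where
  "psd_on B M \<longleftrightarrow>
     (\<forall>\<beta>\<in>B. \<forall>\<gamma>\<in>B. M \<beta> \<gamma> = M \<gamma> \<beta>) \<and>
     (\<forall>v. (\<Sum>\<beta>\<in>B. \<Sum>\<gamma>\<in>B. v \<beta> * M \<beta> \<gamma> * v \<gamma>) \<ge> 0)"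

definition localizing_psd :: "nat \<Rightarrow> 'n::finite mpoly \<Rightarrow> ('n expo \<Rightarrow> real) \<Rightarrow> bool" where
  "localizing_psd d p y \<longleftrightarrow> psd_on (mons (int d - int (half_up (total_degree p)))) (Nmat d p y)"

definition pairing :: "nat \<Rightarrow> 'n::finite mpoly \<Rightarrow> ('n expo \<Rightarrow> real) \<Rightarrow> real" where
  "pairing d f y = (\<Sum>\<alpha>\<in>mons (2 * int d). coef f \<alpha> * y \<alpha>)"

definition L_qmod ::
  "nat \<Rightarrow> (nat \<Rightarrow> 'n::finite mpoly) \<Rightarrow> nat \<Rightarrow> 'n mpoly \<Rightarrow> ('n expo \<Rightarrow> real) set" where
  "L_qmod m g d f = {y \<in> mons (2 * int d) \<rightarrow>\<^sub>E UNIV.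
     y 0 = 1 \<and> pairing d f y \<ge> 0 \<and> (\<forall>i\<le>m. localizing_psd d (gen g i) y)}"

definition L_pre ::
  "nat \<Rightarrow> (nat \<Rightarrow> 'n::finite mpoly) \<Rightarrow> nat \<Rightarrow> 'n mpoly \<Rightarrow> ('n expo \<Rightarrow> real) set" where
  "L_pre m g d f = {y \<in> mons (2 * int d) \<rightarrow>\<^sub>E UNIV.
     y 0 = 1 \<and> pairing d f y \<ge> 0 \<and> (\<forall>\<nu>\<in>cube m. localizing_psd d (gprod m g \<nu>) y)}"

definition proj :: "('n::finite expo \<Rightarrow> real) \<Rightarrow> real ^ 'n" where
  "proj y = (\<chi> i. y (Poly_Mapping.single i 1))"

end

theory Submission
  imports Defs
begin

text \<open>
  A point of \<open>sol_set m g f\<close> lifts to its truncated moment vector, so the content is the converse: if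
  \<open>y\<close> lies in the lifted set, then \<open>b = proj y\<close> lies in \<open>sol_set m g f\<close>. Read \<open>y\<close> as the linear
  functional \<open>\<Lambda> p = pairing d p y\<close>; positive semidefiniteness of the localizing matrix of a generator
  \<open>G\<close> says \<open>\<Lambda> (G * q\<^sup>2) \<ge> 0\<close> for all \<open>q\<close> of small degree. Fix a point \<open>u\<close> of the domain and let \<open>h\<close>
  be \<open>f\<close> or one of the constraints. Substituting \<open>u\<close> in the representation of \<open>- Rem h\<close> writes the
  tangent of \<open>h\<close> at \<open>u\<close> minus \<open>h\<close> as a nonnegative combination of products \<open>G * \<sigma>\<close> with \<open>\<sigma>\<close> a sum of
  squares. As \<open>\<Lambda>\<close> evaluates affine polynomials at \<open>b\<close>, this gives
  \<open>\<Lambda> h \<le> tangent h u b\<close> (\<open>functional_le_tangent\<close>), and \<open>\<Lambda> h \<ge> 0\<close>.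
  So every tangent of every constraint at every point of the domain is nonnegative at \<open>b\<close>.

  If \<open>b\<close> were outside the domain, follow the segment from an interior point to \<open>b\<close> up to the last
  point \<open>u\<close> of the domain. A constraint that vanishes at \<open>u\<close> has a nonnegative directional derivative
  there towards \<open>b\<close>, while concavity on the domain then forces it to be nonpositive, hence zero, on the
  whole first part of the segment; a univariate polynomial vanishing on an interval is zero. So no
  constraint becomes negative just after \<open>u\<close>, a contradiction (\<open>mem_dom_set_of_tangents\<close>).
  Once \<open>b\<close> is in the domain, \<open>u = b\<close> is an admissible base point and \<open>tangent f b b\<close> is the value of
  \<open>f\<close> at \<open>b\<close>.

  The relaxation order bounds only the degrees of the products \<open>G * \<sigma>\<close>, whereas a localizing matrix
  sees a square \<open>q\<^sup>2\<close> only if \<open>q\<close> itself has small degree. The two are linked by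
  \<open>degree_mult_sum_squares\<close>: leading terms cannot cancel in a product with a sum of real squares. It is
  proved by replacing the variables by suitable powers of a single variable.

  The q-module and the preordering case differ only in the index set and the family of generators, so
  everything is done for a family \<open>G\<close> of polynomials over an index set \<open>I\<close>.
\<close>

section \<open>Evaluation of polynomials in commutative rings\<close>

text \<open>
  Evaluation at a point, substitution of polynomials, restriction to a line and the substitution of
  powers of one variable are all instances of this map, so that its homomorphism properties need to be
  proved once. The scalars are embedded by \<open>c\<close>.
\<close>
definition peval :: "(real \<Rightarrow> 'a::comm_ring_1) \<Rightarrow> ('v::finite \<Rightarrow> 'a) \<Rightarrow> 'v mpoly \<Rightarrow> 'a" where
  "peval c s p = (\<Sum>\<alpha>\<in>Poly_Mapping.keys p.
     c (coef p \<alpha>) * (\<Prod>i\<in>UNIV. s i ^ Poly_Mapping.lookup \<alpha> i))"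

locale scalar_hom =
  fixes c :: "real \<Rightarrow> 'a::comm_ring_1"
  assumes zero: "c 0 = 0" and one: "c 1 = 1"
    and add: "c (a + b) = c a + c b" and mult: "c (a * b) = c a * c b"

lemma coef_add: "coef (p + q) \<alpha> = coef p \<alpha> + coef q \<alpha>"
  by (simp add: coef_def lookup_add)

lemma coef_eq_0_iff: "coef p \<alpha> = 0 \<longleftrightarrow> \<alpha> \<notin> Poly_Mapping.keys p"
  by (simp add: coef_def in_keys_iff)

lemma coef_Const_mult: "coef (Const a * p) \<alpha> = a * coef p \<alpha>"
  unfolding Const_def mult_map_scale_conv_mult [symmetric] coef_def
  by (simp add: Poly_Mapping.map.rep_eq when_def)

lemma mpoly_decomposition:
  assumes "finite A" "Poly_Mapping.keys p \<subseteq> A"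
  shows "p = (\<Sum>\<alpha>\<in>A. Poly_Mapping.single \<alpha> (coef p \<alpha>))"
proof (rule poly_mapping_eqI)
  fix k
  have "(\<Sum>\<alpha>\<in>A. Poly_Mapping.lookup (Poly_Mapping.single \<alpha> (coef p \<alpha>)) k)
      = (\<Sum>\<alpha>\<in>A. if \<alpha> = k then coef p k else 0)"
    by (intro sum.cong) (auto simp: lookup_single when_def)
  also have "\<dots> = Poly_Mapping.lookup p k"
    using assms by (auto simp: coef_def in_keys_iff)
  finally show "Poly_Mapping.lookup p k =
      Poly_Mapping.lookup (\<Sum>\<alpha>\<in>A. Poly_Mapping.single \<alpha> (coef p \<alpha>)) k"
    by (simp add: lookup_sum)
qed

lemma single_eq_Const_mult: "Poly_Mapping.single \<alpha> a = Const a * monomial \<alpha>"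
  by (simp add: Const_def monomial_def mult_single)

context scalar_hom
begin

lemma peval_superset:
  assumes "finite A" "Poly_Mapping.keys p \<subseteq> A"
  shows "peval c s p = (\<Sum>\<alpha>\<in>A. c (coef p \<alpha>) * (\<Prod>i\<in>UNIV. s i ^ Poly_Mapping.lookup \<alpha> i))"
  unfolding peval_def using assms
  by (intro sum.mono_neutral_left) (auto simp: coef_eq_0_iff [symmetric] zero)

lemma peval_0 [simp]: "peval c s 0 = 0"
  by (simp add: peval_def)

lemma peval_add: "peval c s (p + q) = peval c s p + peval c s q"
proof -
  let ?A = "Poly_Mapping.keys p \<union> Poly_Mapping.keys q"
  show ?thesis
    using peval_superset [of ?A p s] peval_superset [of ?A q s] peval_superset [of ?A "p + q" s]
      keys_add [of p q]
    by (simp add: coef_add add distrib_right sum.distrib)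
qed

lemma peval_sum: "peval c s (\<Sum>i\<in>A. p i) = (\<Sum>i\<in>A. peval c s (p i))"
  by (induction A rule: infinite_finite_induct) (auto simp: peval_add)

lemma peval_uminus: "peval c s (- p) = - peval c s p"
  using peval_add [of s p "- p"] by (simp add: add_eq_0_iff)

lemma peval_diff: "peval c s (p - q) = peval c s p - peval c s q"
  using peval_add [of s p "- q"] by (simp add: peval_uminus)

lemma peval_single:
  "peval c s (Poly_Mapping.single \<alpha> a) = c a * (\<Prod>i\<in>UNIV. s i ^ Poly_Mapping.lookup \<alpha> i)"
  using peval_superset [of "{\<alpha>}" "Poly_Mapping.single \<alpha> a" s]
  by (simp add: coef_def split: if_splits)

lemma peval_mult: "peval c s (p * q) = peval c s p * peval c s q"
proof -
  let ?S = "\<lambda>p. \<Sum>\<alpha>\<in>Poly_Mapping.keys p. Poly_Mapping.single \<alpha> (coef p \<alpha>)"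
  have "p * q = ?S p * ?S q"
    using mpoly_decomposition [OF finite_keys order_refl] by metis
  also have "peval c s \<dots> = (\<Sum>\<alpha>\<in>Poly_Mapping.keys p. \<Sum>\<beta>\<in>Poly_Mapping.keys q.
      peval c s (Poly_Mapping.single \<alpha> (coef p \<alpha>)) * peval c s (Poly_Mapping.single \<beta> (coef q \<beta>)))"
    by (simp add: sum_product peval_sum mult_single peval_single mult lookup_add power_add
        prod.distrib mult_ac)
  also have "\<dots> = peval c s (?S p) * peval c s (?S q)"
    by (simp add: sum_product peval_sum)
  also have "\<dots> = peval c s p * peval c s q"
    using mpoly_decomposition [OF finite_keys order_refl] by metis
  finally show ?thesis .
qed

lemma peval_Const [simp]: "peval c s (Const a) = c a"
  by (simp add: Const_def peval_single)

lemma peval_1 [simp]: "peval c s 1 = 1"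
  using peval_Const [of s 1] by (simp add: Const_def one)

lemma peval_Var [simp]: "peval c s (Var i) = s i"
proof -
  have "(\<Prod>j\<in>UNIV. s j ^ Poly_Mapping.lookup (Poly_Mapping.single i 1) j)
      = (\<Prod>j\<in>UNIV. if j = i then s i else 1)"
    by (intro prod.cong) (auto simp: lookup_single when_def)
  then show ?thesis by (simp add: Var_def monomial_def peval_single one)
qed

lemma peval_power: "peval c s (p ^ k) = peval c s p ^ k"
  by (induction k) (auto simp: peval_mult)

lemma peval_prod: "peval c s (\<Prod>i\<in>A. p i) = (\<Prod>i\<in>A. peval c s (p i))"
  by (induction A rule: infinite_finite_induct) (auto simp: peval_mult)

end


text \<open>This turns iterated evaluations into a single one, as in a substitution followed by another.\<close>
lemma hom_peval:
  fixes \<phi> :: "'a::comm_ring_1 \<Rightarrow> 'b::comm_ring_1"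
  assumes "\<phi> 0 = 0" "\<phi> 1 = 1" "\<And>a b. \<phi> (a + b) = \<phi> a + \<phi> b" "\<And>a b. \<phi> (a * b) = \<phi> a * \<phi> b"
  shows "\<phi> (peval c s p) = peval (\<lambda>a. \<phi> (c a)) (\<lambda>i. \<phi> (s i)) p"
proof -
  have s: "\<phi> (sum F A) = (\<Sum>x\<in>A. \<phi> (F x))" for F :: "'z \<Rightarrow> 'a" and A
    by (induction A rule: infinite_finite_induct) (auto simp: assms)
  have p: "\<phi> (prod F A) = (\<Prod>x\<in>A. \<phi> (F x))" for F :: "'z \<Rightarrow> 'a" and A
    by (induction A rule: infinite_finite_induct) (auto simp: assms)
  have e: "\<phi> (a ^ k) = \<phi> a ^ k" for a k
    by (induction k) (auto simp: assms)
  show ?thesis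
    by (simp add: peval_def s p e assms)
qed

interpretation Const: scalar_hom Const
  by unfold_locales (auto simp: Const_def single_add mult_single)

interpretation real: scalar_hom "\<lambda>a::real. a"
  by unfold_locales auto

interpretation poly: scalar_hom "\<lambda>a::real. [:a:]"
  by unfold_locales (auto simp: one_pCons)

lemma evalp_eq_peval: "evalp p x = peval (\<lambda>a. a) (($) x) p"
  by (simp add: evalp_def peval_def)

lemma subst_eq_peval: "subst s p = peval Const s p"
proof -
  have "(\<Prod>i\<in>Poly_Mapping.keys \<alpha>. s i ^ Poly_Mapping.lookup \<alpha> i)
      = (\<Prod>i\<in>UNIV. s i ^ Poly_Mapping.lookup \<alpha> i)" for \<alpha>
    by (intro prod.mono_neutral_left) (auto simp: in_keys_iff)
  then show ?thesis by (simp add: subst_def peval_def)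
qed

lemma evalp_simps [simp]:
  "evalp 0 x = 0" "evalp 1 x = 1" "evalp (Const a) x = a" "evalp (Var i) x = x $ i"
  "evalp (p + q) x = evalp p x + evalp q x" "evalp (p - q) x = evalp p x - evalp q x"
  "evalp (- p) x = - evalp p x" "evalp (p * q) x = evalp p x * evalp q x"
  "evalp (p ^ k) x = evalp p x ^ k"
  by (simp_all add: evalp_eq_peval real.peval_add real.peval_diff real.peval_uminus
      real.peval_mult real.peval_power)

lemma evalp_sum: "evalp (\<Sum>i\<in>A. P i) x = (\<Sum>i\<in>A. evalp (P i) x)"
  by (simp add: evalp_eq_peval real.peval_sum)

lemma evalp_prod: "evalp (\<Prod>i\<in>A. P i) x = (\<Prod>i\<in>A. evalp (P i) x)"
  by (simp add: evalp_eq_peval real.peval_prod)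

lemma monomial_eq_prod_Var:
  "monomial \<alpha> = (\<Prod>i\<in>UNIV. Var i ^ Poly_Mapping.lookup \<alpha> i)" for \<alpha> :: "'v::finite expo"
proof -
  have pow: "(Var i :: 'v mpoly) ^ k = Poly_Mapping.single (Poly_Mapping.single i k) 1" for i k
    by (induction k) (auto simp: Var_def monomial_def mult_single single_add [symmetric])
  have "(\<Prod>i\<in>A. (Var i :: 'v mpoly) ^ Poly_Mapping.lookup \<alpha> i)
      = Poly_Mapping.single (\<Sum>i\<in>A. Poly_Mapping.single i (Poly_Mapping.lookup \<alpha> i)) 1" for A
    by (induction A rule: infinite_finite_induct) (auto simp: pow mult_single)
  moreover have "(\<Sum>i\<in>UNIV. Poly_Mapping.single i (Poly_Mapping.lookup \<alpha> i)) = \<alpha>"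
    by (rule poly_mapping_eqI) (simp add: lookup_sum lookup_single when_def)
  ultimately show ?thesis by (simp add: monomial_def)
qed

lemma evalp_monomial: "evalp (monomial \<alpha>) x = (\<Prod>i\<in>UNIV. (x $ i) ^ Poly_Mapping.lookup \<alpha> i)"
  by (simp add: monomial_eq_prod_Var evalp_prod)

lemma peval_Const_Var: "peval Const Var p = p"
  using mpoly_decomposition [OF finite_keys order_refl, of p]
  by (simp add: peval_def single_eq_Const_mult monomial_eq_prod_Var)

text \<open>
  Freezing the second group of variables at a point \<open>u\<close> turns an identity in two groups of variables
  into one between ordinary polynomials.
\<close>
definition at_u :: "real ^ 'n \<Rightarrow> ('n + 'n::finite) mpoly \<Rightarrow> 'n mpoly" where
  "at_u u = peval Const (case_sum Var (\<lambda>i. Const (u $ i)))"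

lemma at_u_simps [simp]:
  "at_u u 0 = 0" "at_u u 1 = 1" "at_u u (Const a) = Const a"
  "at_u u (Var (Inl i)) = Var i" "at_u u (Var (Inr i)) = Const (u $ i)"
  "at_u u (p + q) = at_u u p + at_u u q" "at_u u (p - q) = at_u u p - at_u u q"
  "at_u u (- p) = - at_u u p" "at_u u (p * q) = at_u u p * at_u u q"
  "at_u u (p ^ k) = at_u u p ^ k"
  by (simp_all add: at_u_def Const.peval_add Const.peval_diff Const.peval_uminus
      Const.peval_mult Const.peval_power)

lemma at_u_sum: "at_u u (\<Sum>i\<in>A. P i) = (\<Sum>i\<in>A. at_u u (P i))"
  by (simp add: at_u_def Const.peval_sum)

lemma at_u_in_x [simp]: "at_u u (in_x p) = p"
proof -
  have "at_u u (in_x p) = peval (\<lambda>a. at_u u (Const a)) (\<lambda>i. at_u u (Var (Inl i))) p"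
    unfolding in_x_def subst_eq_peval by (rule hom_peval) auto
  then show ?thesis by (simp add: peval_Const_Var)
qed

lemma at_u_in_u [simp]: "at_u u (in_u p) = Const (evalp p u)" for p :: "'n::finite mpoly"
proof -
  have "at_u u (in_u p) = peval (\<lambda>a. at_u u (Const a)) (\<lambda>i. at_u u (Var (Inr i))) p"
    unfolding in_u_def subst_eq_peval by (rule hom_peval) auto
  moreover have "(Const (evalp p u) :: 'n mpoly) = peval Const (\<lambda>i. Const (u $ i)) p"
    unfolding evalp_eq_peval
    by (rule hom_peval) (auto simp: Const.zero Const.one Const.add Const.mult)
  ultimately show ?thesis by simp
qed

section \<open>Degrees\<close>

lemma total_degree_le_iff:
  "total_degree p \<le> k \<longleftrightarrow> (\<forall>\<alpha>\<in>Poly_Mapping.keys p. expo_degree \<alpha> \<le> k)"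
  by (auto simp: total_degree_def degree_in_def expo_degree_def)

lemma expo_degree_le_total_degree: "\<alpha> \<in> Poly_Mapping.keys p \<Longrightarrow> expo_degree \<alpha> \<le> total_degree p"
  using total_degree_le_iff by blast

lemma expo_degree_add [simp]: "expo_degree (\<alpha> + \<beta>) = expo_degree \<alpha> + expo_degree \<beta>"
  by (simp add: expo_degree_def lookup_add sum.distrib)

lemma expo_degree_0 [simp]: "expo_degree 0 = 0"
  by (simp add: expo_degree_def)

lemma expo_degree_single [simp]: "expo_degree (Poly_Mapping.single i k) = k"
  by (simp add: expo_degree_def lookup_single when_def)

lemma total_degree_add_le:
  "total_degree p \<le> k \<Longrightarrow> total_degree q \<le> k \<Longrightarrow> total_degree (p + q) \<le> k"
  using keys_add [of p q] unfolding total_degree_le_iff by blast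

lemma total_degree_uminus [simp]: "total_degree (- p) = total_degree p"
proof -
  have "Poly_Mapping.keys (- p) = Poly_Mapping.keys p" by (auto simp: in_keys_iff)
  then show ?thesis by (simp add: total_degree_def degree_in_def)
qed

lemma total_degree_diff_le:
  "total_degree p \<le> k \<Longrightarrow> total_degree q \<le> k \<Longrightarrow> total_degree (p - q) \<le> k"
  using total_degree_add_le [of p k "- q"] by simp

lemma total_degree_mult_le:
  assumes "total_degree p \<le> k" "total_degree q \<le> l"
  shows "total_degree (p * q) \<le> k + l"
  using keys_mult [of p q] assms unfolding total_degree_le_iff by (fastforce intro: add_mono)

lemma total_degree_Const [simp]: "total_degree (Const a) = 0"
  by (auto simp: Const_def total_degree_def degree_in_def)

lemma total_degree_0 [simp]: "total_degree 0 = 0"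
  using total_degree_le_iff [of 0 0] by auto

lemma total_degree_1 [simp]: "total_degree 1 = 0"
  using total_degree_le_iff [of 1 0] by auto

lemma total_degree_monomial [simp]: "total_degree (monomial \<alpha>) = expo_degree \<alpha>"
  using total_degree_le_iff [of "monomial \<alpha>"]
  by (intro antisym) (auto simp: monomial_def intro: expo_degree_le_total_degree)

lemma total_degree_Var [simp]: "total_degree (Var i) = 1"
  by (simp add: Var_def)

lemma total_degree_sum_le:
  "(\<And>i. i \<in> A \<Longrightarrow> total_degree (P i) \<le> k) \<Longrightarrow> total_degree (\<Sum>i\<in>A. P i) \<le> k"
  by (induction A rule: infinite_finite_induct) (auto intro: total_degree_add_le)

lemma total_degree_power_le: "total_degree (p ^ k) \<le> k * total_degree p"
  by (induction k) (auto intro: total_degree_mult_le)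

lemma total_degree_prod_le: "total_degree (\<Prod>i\<in>A. P i) \<le> (\<Sum>i\<in>A. total_degree (P i))"
  by (induction A rule: infinite_finite_induct) (auto intro: total_degree_mult_le)

lemma degree_in_bound:
  "\<alpha> \<in> Poly_Mapping.keys p \<Longrightarrow> (\<Sum>i\<in>V. Poly_Mapping.lookup \<alpha> i) \<le> degree_in V p"
  by (auto simp: degree_in_def)

lemma total_degree_at_u_le: "total_degree (at_u u p) \<le> degree_x p"
  unfolding at_u_def peval_def
proof (rule total_degree_sum_le)
  fix \<alpha> assume \<alpha>: "\<alpha> \<in> Poly_Mapping.keys p"
  let ?s = "case_sum Var (\<lambda>i. Const (u $ i))" and ?a = "Poly_Mapping.lookup \<alpha>"
  have "total_degree (\<Prod>i\<in>UNIV. ?s i ^ ?a i) \<le> (\<Sum>i\<in>UNIV. total_degree (?s i ^ ?a i))"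
    by (rule total_degree_prod_le)
  also have "\<dots> \<le> (\<Sum>i\<in>UNIV. ?a i * total_degree (?s i))"
    by (intro sum_mono total_degree_power_le)
  also have "\<dots> = (\<Sum>i\<in>range Inl. ?a i)"
    by (rule sum.mono_neutral_cong_right) (auto split: sum.splits)
  also have "\<dots> \<le> degree_x p"
    unfolding degree_x_def using \<alpha> by (rule degree_in_bound)
  finally show "total_degree (Const (coef p \<alpha>) * (\<Prod>i\<in>UNIV. ?s i ^ ?a i)) \<le> degree_x p"
    using total_degree_mult_le [of "Const (coef p \<alpha>)" 0] by fastforce
qed

text \<open>
  The coefficient of the sum at twice the largest degree \<open>D\<close> is the sum of the squares of the
  coefficients at \<open>D\<close>, and a sum of real squares vanishes only if all of them do.
\<close>
lemma sum_squares_degree: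
  fixes r :: "'i \<Rightarrow> real poly"
  assumes "finite L" "k \<in> L" "r k \<noteq> 0"
  shows "(\<Sum>l\<in>L. (r l)\<^sup>2) \<noteq> 0 \<and> 2 * Polynomial.degree (r k) \<le> Polynomial.degree (\<Sum>l\<in>L. (r l)\<^sup>2)"
proof -
  define D where "D = Max ((\<lambda>l. Polynomial.degree (r l)) ` L)"
  have le: "Polynomial.degree (r l) \<le> D" if "l \<in> L" for l
    using assms that by (auto simp: D_def)
  have sq: "poly.coeff ((r l)\<^sup>2) (2 * D) = (poly.coeff (r l) D)\<^sup>2" if "l \<in> L" for l
  proof (cases "Polynomial.degree (r l) = D")
    case True
    then show ?thesis
      using coeff_mult_degree_sum [of "r l" "r l"] by (simp add: power2_eq_square mult_2)
  next
    case False
    then have lt: "Polynomial.degree (r l) < D" using le [OF that] by simp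
    have "Polynomial.degree ((r l)\<^sup>2) < 2 * D"
      using degree_power_le [of "r l" 2] lt by simp
    then show ?thesis using lt by (simp add: coeff_eq_0)
  qed
  \<comment> \<open>The summand attaining \<open>D\<close> may be \<open>0\<close>, which also has degree \<open>0\<close>; then \<open>r k\<close> attains \<open>D\<close> too.\<close>
  have "D \<in> (\<lambda>l. Polynomial.degree (r l)) ` L"
    unfolding D_def using assms by (intro Max_in) auto
  then obtain l where l: "l \<in> L" "Polynomial.degree (r l) = D" by auto
  obtain l' where l': "l' \<in> L" "Polynomial.degree (r l') = D" "r l' \<noteq> 0"
  proof (cases "r l = 0")
    case True
    then have "D = 0" using l by simp
    then show ?thesis using that [of k] assms le [of k] by simp
  qed (use l that in blast)
  have "poly.coeff (\<Sum>l\<in>L. (r l)\<^sup>2) (2 * D) = (\<Sum>l\<in>L. (poly.coeff (r l) D)\<^sup>2)"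
    by (simp add: coeff_sum sq)
  moreover have "\<dots> > 0"
    using assms l' by (intro sum_pos2 [of L l']) auto
  ultimately have nz: "poly.coeff (\<Sum>l\<in>L. (r l)\<^sup>2) (2 * D) \<noteq> 0" by simp
  then have "2 * D \<le> Polynomial.degree (\<Sum>l\<in>L. (r l)\<^sup>2)" by (rule le_degree)
  moreover have "(\<Sum>l\<in>L. (r l)\<^sup>2) \<noteq> 0" using nz by force
  ultimately show ?thesis using le [of k] assms by simp
qed

text \<open>
  This is the uniqueness of digits to base \<open>N\<close>: the weights are the powers of \<open>N\<close> in some enumeration
  of \<open>F\<close>, built up by shifting the old digits and putting the new one last.
\<close>
lemma ex_separating_weight:
  fixes F :: "'v set"
  assumes "finite F"
  shows "\<exists>w :: 'v \<Rightarrow> nat. \<forall>a b. (\<forall>i\<in>F. a i < N \<and> b i < N) \<and> (\<Sum>i\<in>F. w i * a i) = (\<Sum>i\<in>F. w i * b i)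
    \<longrightarrow> (\<forall>i\<in>F. a i = b i)"
  using assms
proof induction
  case (insert j F)
  then obtain w :: "'v \<Rightarrow> nat" where w: "\<And>a b. \<forall>i\<in>F. a i < N \<and> b i < N \<Longrightarrow>
      (\<Sum>i\<in>F. w i * a i) = (\<Sum>i\<in>F. w i * b i) \<Longrightarrow> \<forall>i\<in>F. a i = b i" by blast
  define w' where "w' = (\<lambda>i. if i = j then 1 else N * w i)"
  have w'_sum: "(\<Sum>i\<in>insert j F. w' i * a i) = a j + N * (\<Sum>i\<in>F. w i * a i)" for a
  proof -
    have "(\<Sum>i\<in>F. w' i * a i) = (\<Sum>i\<in>F. N * (w i * a i))"
      using insert by (intro sum.cong) (auto simp: w'_def)
    then show ?thesis using insert by (simp add: w'_def sum_distrib_left)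
  qed
  show ?case
  proof (intro exI [of _ w'] allI impI)
    fix a b :: "'v \<Rightarrow> nat"
    assume *: "(\<forall>i\<in>insert j F. a i < N \<and> b i < N) \<and>
      (\<Sum>i\<in>insert j F. w' i * a i) = (\<Sum>i\<in>insert j F. w' i * b i)"
    have eq: "a j + N * (\<Sum>i\<in>F. w i * a i) = b j + N * (\<Sum>i\<in>F. w i * b i)"
      using conjunct2 [OF *] unfolding w'_sum .
    have lt: "a j < N" "b j < N" using * by blast+
    have "a j = b j" using arg_cong [OF eq, of "\<lambda>k. k mod N"] lt by simp
    moreover have "(\<Sum>i\<in>F. w i * a i) = (\<Sum>i\<in>F. w i * b i)"
      using arg_cong [OF eq, of "\<lambda>k. k div N"] lt by simp
    moreover have "\<forall>i\<in>F. a i < N \<and> b i < N" using * by blast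
    ultimately show "\<forall>i\<in>insert j F. a i = b i" using w [of a b] by blast
  qed
qed auto

text \<open>
  Kronecker substitution adapted to the total degree. The \<open>i\<close>-th variable becomes the power \<open>M + w i\<close> of
  a single variable, so a monomial is sent to a power whose quotient by \<open>M\<close> is its degree and whose
  remainder identifies it among the monomials in question. Hence distinct monomials stay distinct, and
  the degree of the image determines the total degree up to an error smaller than \<open>M\<close>.
\<close>
lemma ex_univariate_image:
  fixes \<P> :: "'v::finite mpoly set"
  assumes "finite \<P>"
  shows "\<exists>M>0. \<exists>s :: 'v \<Rightarrow> real poly. \<forall>p\<in>\<P>. p \<noteq> 0 \<longrightarrow> peval (\<lambda>a. [:a:]) s p \<noteq> 0 \<and>
    M * total_degree p \<le> Polynomial.degree (peval (\<lambda>a. [:a:]) s p) \<and>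
    Polynomial.degree (peval (\<lambda>a. [:a:]) s p) < M * (total_degree p + 1)"
proof -
  define K where "K = (\<Union>p\<in>\<P>. Poly_Mapping.keys p)"
  have "finite K" using assms by (simp add: K_def)
  define N where "N = Suc (Max (insert 0 (expo_degree ` K)))"
  have deg_N: "expo_degree \<alpha> < N" if "\<alpha> \<in> K" for \<alpha>
    using that \<open>finite K\<close> by (auto simp: N_def less_Suc_eq_le)
  have lookup_N: "Poly_Mapping.lookup \<alpha> i < N" if "\<alpha> \<in> K" for \<alpha> i
    using deg_N [OF that] member_le_sum [of i UNIV "Poly_Mapping.lookup \<alpha>"]
    by (simp add: expo_degree_def)
  obtain w :: "'v \<Rightarrow> nat" where w0: "\<forall>a b. (\<forall>i\<in>UNIV. a i < N \<and> b i < N) \<and>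
      (\<Sum>i\<in>UNIV. w i * a i) = (\<Sum>i\<in>UNIV. w i * b i) \<longrightarrow> (\<forall>i\<in>UNIV. a i = b i)"
    using ex_separating_weight [OF finite, of "UNIV :: 'v set" N] by (elim exE)
  have w: "\<forall>i. a i = b i"
    if "\<forall>i. a i < N \<and> b i < N" "(\<Sum>i\<in>UNIV. w i * a i) = (\<Sum>i\<in>UNIV. w i * b i)" for a b
    using w0 [rule_format, of a b] that by simp
  define tail where "tail = (\<lambda>\<alpha>. \<Sum>i\<in>UNIV. w i * Poly_Mapping.lookup \<alpha> i)"
  define M where "M = Suc (\<Sum>i\<in>UNIV. w i * N)"
  define s where "s = (\<lambda>i::'v. Polynomial.monom (1::real) (M + w i))"
  define W where "W = (\<lambda>\<alpha>. M * expo_degree \<alpha> + tail \<alpha>)"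
  have tail_M: "tail \<alpha> < M" if "\<alpha> \<in> K" for \<alpha>
    using lookup_N [OF that] unfolding tail_def M_def
    by (auto intro!: sum_mono simp: less_Suc_eq_le less_imp_le)
  have W_inj: "\<alpha> = \<beta>" if "\<alpha> \<in> K" "\<beta> \<in> K" "W \<alpha> = W \<beta>" for \<alpha> \<beta>
  proof -
    have "tail \<alpha> = tail \<beta>"
      using arg_cong [OF that(3), of "\<lambda>k. k mod M"] tail_M that by (simp add: W_def)
    then have "\<forall>i. Poly_Mapping.lookup \<alpha> i = Poly_Mapping.lookup \<beta> i"
      using that lookup_N unfolding tail_def by (intro w) auto
    then show ?thesis by (simp add: poly_mapping_eqI)
  qed
  have term_W: "[:c:] * (\<Prod>i\<in>UNIV. s i ^ Poly_Mapping.lookup \<alpha> i) = Polynomial.monom c (W \<alpha>)" for c \<alpha>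
  proof -
    have "(\<Prod>i\<in>A. s i ^ a i) = Polynomial.monom 1 (\<Sum>i\<in>A. (M + w i) * a i)" for A a
      by (induction A rule: infinite_finite_induct)
        (auto simp: s_def monom_power mult_monom)
    then have "(\<Prod>i\<in>UNIV. s i ^ Poly_Mapping.lookup \<alpha> i) = Polynomial.monom 1 (W \<alpha>)"
      by (simp add: W_def tail_def expo_degree_def algebra_simps sum.distrib sum_distrib_left)
    then show ?thesis by (simp add: smult_monom)
  qed
  let ?h = "peval (\<lambda>a. [:a:]) s"
  have image: "?h p = (\<Sum>\<alpha>\<in>Poly_Mapping.keys p. Polynomial.monom (coef p \<alpha>) (W \<alpha>))" for p
    unfolding peval_def by (simp only: term_W)
  have "?h p \<noteq> 0 \<and> M * total_degree p \<le> Polynomial.degree (?h p) \<and>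
      Polynomial.degree (?h p) < M * (total_degree p + 1)" if "p \<in> \<P>" "p \<noteq> 0" for p
  proof -
    have keys: "Poly_Mapping.keys p \<subseteq> K" using that by (auto simp: K_def)
    have ne: "Poly_Mapping.keys p \<noteq> {}"
      using that(2) by (auto simp: poly_mapping_eq_iff fun_eq_iff in_keys_iff)
    obtain \<alpha> where \<alpha>: "\<alpha> \<in> Poly_Mapping.keys p" "expo_degree \<alpha> = total_degree p"
    proof -
      have "total_degree p \<le> Max (expo_degree ` Poly_Mapping.keys p)"
        by (simp add: total_degree_le_iff)
      moreover have "Max (expo_degree ` Poly_Mapping.keys p) \<in> expo_degree ` Poly_Mapping.keys p"
        using ne by (intro Max_in) auto
      ultimately show ?thesis using that expo_degree_le_total_degree by fastforce
    qed
    have "poly.coeff (?h p) (W \<alpha>) = (\<Sum>\<beta>\<in>Poly_Mapping.keys p. if \<beta> = \<alpha> then coef p \<beta> else 0)"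
      unfolding image coeff_sum using W_inj keys \<alpha>(1)
      by (intro sum.cong) (auto simp: subset_iff)
    then have nz: "poly.coeff (?h p) (W \<alpha>) \<noteq> 0" using \<alpha>(1) by (simp add: coef_eq_0_iff)
    have W_less: "W \<beta> < M * (total_degree p + 1)" if "\<beta> \<in> Poly_Mapping.keys p" for \<beta>
    proof -
      have "M * expo_degree \<beta> \<le> M * total_degree p"
        using expo_degree_le_total_degree [OF that] by simp
      moreover have "tail \<beta> < M" using tail_M keys that by blast
      ultimately show ?thesis unfolding W_def distrib_left by linarith
    qed
    have "Polynomial.degree (Polynomial.monom (coef p \<beta>) (W \<beta>)) \<le> M * (total_degree p + 1) - 1"
      if "\<beta> \<in> Poly_Mapping.keys p" for \<beta>
      using degree_monom_le [of "coef p \<beta>" "W \<beta>"] W_less [OF that] by linarith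
    then have "Polynomial.degree (?h p) \<le> M * (total_degree p + 1) - 1"
      unfolding image by (intro degree_sum_le) auto
    then have "Polynomial.degree (?h p) < M * (total_degree p + 1)"
      by (simp add: M_def)
    moreover have "M * total_degree p \<le> Polynomial.degree (?h p)"
      using le_degree [OF nz] \<alpha>(2) by (simp add: W_def)
    moreover have "?h p \<noteq> 0" using nz by force
    ultimately show ?thesis by simp
  qed
  moreover have "M > 0" by (simp add: M_def)
  ultimately show ?thesis by blast
qed

text \<open>
  For univariate polynomials the degree of a product is the sum of the degrees, and \<open>sum_squares_degree\<close>
  applies; under Kronecker substitution the inequality is multiplied by \<open>M\<close> with an error less than \<open>M\<close>,
  which rounding removes.
\<close>
lemma degree_mult_sum_squares:
  fixes p :: "'v::finite mpoly"
  assumes "finite L" "l \<in> L" "p \<noteq> 0" "q l \<noteq> 0"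
  shows "total_degree p + 2 * total_degree (q l) \<le> total_degree (p * (\<Sum>l\<in>L. (q l)\<^sup>2))"
proof -
  let ?r = "p * (\<Sum>l\<in>L. (q l)\<^sup>2)"
  obtain M and s :: "'v \<Rightarrow> real poly" where M: "M > 0"
    and deg: "\<And>t. t \<in> {p, q l, ?r} \<Longrightarrow> t \<noteq> 0 \<Longrightarrow> peval (\<lambda>a. [:a:]) s t \<noteq> 0 \<and>
      M * total_degree t \<le> Polynomial.degree (peval (\<lambda>a. [:a:]) s t) \<and>
      Polynomial.degree (peval (\<lambda>a. [:a:]) s t) < M * (total_degree t + 1)"
    using ex_univariate_image [of "{p, q l, ?r}"] by blast
  let ?h = "peval (\<lambda>a. [:a:]) s"
  have h_r: "?h ?r = ?h p * (\<Sum>l\<in>L. (?h (q l))\<^sup>2)"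
    by (simp add: poly.peval_mult poly.peval_sum poly.peval_power)
  have sq: "(\<Sum>l\<in>L. (?h (q l))\<^sup>2) \<noteq> 0"
      "2 * Polynomial.degree (?h (q l)) \<le> Polynomial.degree (\<Sum>l\<in>L. (?h (q l))\<^sup>2)"
    using sum_squares_degree [of L l "\<lambda>l. ?h (q l)"] assms deg [of "q l"] by auto
  have h_p: "?h p \<noteq> 0" using deg [of p] assms by auto
  have "?h ?r \<noteq> 0" using h_r sq h_p by simp
  then have "?r \<noteq> 0" using poly.peval_0 by metis
  have "M * (total_degree p + 2 * total_degree (q l)) \<le> Polynomial.degree (?h p) + 2 * Polynomial.degree (?h (q l))"
    using deg [of p] deg [of "q l"] assms by (simp add: algebra_simps)
  also have "\<dots> \<le> Polynomial.degree (?h ?r)"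
    using sq h_p by (simp add: h_r degree_mult_eq)
  also have "\<dots> < M * (total_degree ?r + 1)"
    using deg [of ?r] \<open>?r \<noteq> 0\<close> by simp
  finally show ?thesis using M by (simp only: mult_less_cancel1) simp
qed

section \<open>Moment functionals\<close>

lemma half_up_bounds: "k \<le> 2 * half_up k" "2 * half_up k \<le> k + 1"
proof -
  have *: "k \<le> 2 * h \<and> 2 * h \<le> k + 1"
    if "real h = real_of_int c" "real k / 2 \<le> real_of_int c" "real_of_int c < real k / 2 + 1"
    for h :: nat and c :: int
    using that by linarith
  have "real (half_up k) = real_of_int \<lceil>real k / 2\<rceil>" by (simp add: half_up_def)
  from * [OF this] ceiling_correct [of "real k / 2"]
  show "k \<le> 2 * half_up k" "2 * half_up k \<le> k + 1" by auto
qed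

lemma finite_mons [simp]: "finite (mons k :: 'n::finite expo set)"
proof -
  have "Poly_Mapping.lookup ` (mons k :: 'n expo set) \<subseteq> (UNIV \<rightarrow>\<^sub>E {..nat k})"
  proof (clarsimp simp: PiE_UNIV_domain mons_def)
    fix \<alpha> :: "'n expo" and i assume "int (expo_degree \<alpha>) \<le> k"
    moreover have "Poly_Mapping.lookup \<alpha> i \<le> expo_degree \<alpha>"
      unfolding expo_degree_def by (rule member_le_sum) auto
    ultimately show "Poly_Mapping.lookup \<alpha> i \<le> nat k" by linarith
  qed
  then have "finite (Poly_Mapping.lookup ` (mons k :: 'n expo set))"
    by (rule finite_subset) (rule finite_PiE, simp_all)
  then show ?thesis
    by (rule finite_imageD) (auto simp: inj_on_def)
qed

lemma keys_subset_mons: "int (total_degree p) \<le> k \<Longrightarrow> Poly_Mapping.keys p \<subseteq> mons k"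
  using expo_degree_le_total_degree [of _ p] by (force simp: mons_def)

lemma pairing_add: "pairing d (p + q) y = pairing d p y + pairing d q y"
  by (simp add: pairing_def coef_add distrib_right sum.distrib)

lemma pairing_scale: "pairing d (Const a * p) y = a * pairing d p y"
  by (simp add: pairing_def coef_Const_mult sum_distrib_left mult.assoc)

lemma pairing_0 [simp]: "pairing d 0 y = 0"
  by (simp add: pairing_def coef_def)

lemma pairing_sum: "pairing d (\<Sum>i\<in>A. P i) y = (\<Sum>i\<in>A. pairing d (P i) y)"
  by (induction A rule: infinite_finite_induct) (auto simp: pairing_add)

lemma pairing_monomial:
  assumes "expo_degree \<alpha> \<le> 2 * d"
  shows "pairing d (monomial \<alpha>) y = y \<alpha>"
proof -
  have \<alpha>: "\<alpha> \<in> mons (2 * int d)" using assms by (simp add: mons_def)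
  have "pairing d (monomial \<alpha>) y = (\<Sum>\<beta>\<in>mons (2 * int d). if \<beta> = \<alpha> then y \<beta> else 0)"
    unfolding pairing_def
    by (intro sum.cong) (auto simp: coef_def monomial_def lookup_single when_def)
  also have "\<dots> = y \<alpha>" using \<alpha> by simp
  finally show ?thesis .
qed

lemma Nmat_eq_pairing: "Nmat d p y \<beta> \<gamma> = pairing d (p * monomial \<beta> * monomial \<gamma>) y"
  by (simp add: Nmat_def Gmat_def pairing_def)

text \<open>This pairing is the quadratic form of the localizing matrix at the coefficient vector of \<open>q\<close>.\<close>
lemma pairing_square_nonneg:
  assumes psd: "localizing_psd d p y" and deg: "half_up (total_degree p) + total_degree q \<le> d"
  shows "0 \<le> pairing d (p * q\<^sup>2) y"
proof -
  define B where "B = (mons (int d - int (half_up (total_degree p))) :: 'a expo set)"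
  have "Poly_Mapping.keys q \<subseteq> B"
    unfolding B_def using deg by (intro keys_subset_mons) linarith
  then have q: "q = (\<Sum>\<beta>\<in>B. Const (coef q \<beta>) * monomial \<beta>)"
    using mpoly_decomposition [of B q] by (simp add: B_def single_eq_Const_mult)
  let ?t = "\<lambda>\<beta>. Const (coef q \<beta>) * monomial \<beta>"
  have "p * q\<^sup>2 = p * (sum ?t B * sum ?t B)"
    by (simp only: power2_eq_square q [symmetric])
  also have "\<dots> = (\<Sum>\<beta>\<in>B. \<Sum>\<gamma>\<in>B. p * (?t \<beta> * ?t \<gamma>))"
    by (simp only: sum_product) (simp only: sum_distrib_left)
  also have "\<dots> = (\<Sum>\<beta>\<in>B. \<Sum>\<gamma>\<in>B. Const (coef q \<beta> * coef q \<gamma>) * (p * monomial \<beta> * monomial \<gamma>))"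
    by (intro sum.cong refl) (simp only: Const.mult mult_ac)
  finally have "pairing d (p * q\<^sup>2) y = (\<Sum>\<beta>\<in>B. \<Sum>\<gamma>\<in>B. coef q \<beta> * Nmat d p y \<beta> \<gamma> * coef q \<gamma>)"
    by (simp add: pairing_sum pairing_scale Nmat_eq_pairing mult_ac [where 'a = real])
  then show ?thesis
    using psd by (auto simp: localizing_psd_def psd_on_def B_def)
qed

text \<open>
  Only the degree of the whole product is bounded; by \<open>degree_mult_sum_squares\<close> every single square in
  \<open>\<sigma>\<close> is then small enough to be seen by the localizing matrix. If that matrix is void, then \<open>p * \<sigma>\<close>
  must be \<open>0\<close>.
\<close>
lemma pairing_sos_nonneg:
  assumes psd: "localizing_psd d p y" and "sos \<sigma>" and deg: "total_degree (p * \<sigma>) \<le> 2 * d"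
  shows "0 \<le> pairing d (p * \<sigma>) y"
proof -
  obtain k :: nat and q where \<sigma>: "\<sigma> = (\<Sum>l<k. (q l)\<^sup>2)"
    using assms(2) by (auto simp: sos_def)
  have "0 \<le> pairing d (p * (q l)\<^sup>2) y" if "l < k" for l
  proof (cases "p = 0 \<or> q l = 0")
    case False
    then have "total_degree p + 2 * total_degree (q l) \<le> 2 * d"
      using degree_mult_sum_squares [of "{..<k}" l p q] that deg by (simp add: \<sigma>)
    then have "half_up (total_degree p) + total_degree (q l) \<le> d"
      using half_up_bounds [of "total_degree p"] by linarith
    then show ?thesis using psd by (intro pairing_square_nonneg)
  qed auto
  then show ?thesis by (auto simp: \<sigma> sum_distrib_left pairing_sum intro!: sum_nonneg)
qed

definition moments :: "nat \<Rightarrow> real ^ 'n \<Rightarrow> 'n::finite expo \<Rightarrow> real" where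
  "moments d x = restrict (\<lambda>\<alpha>. evalp (monomial \<alpha>) x) (mons (2 * int d))"

lemma pairing_moments:
  assumes "total_degree p \<le> 2 * d"
  shows "pairing d p (moments d x) = evalp p x"
proof -
  have "Poly_Mapping.keys p \<subseteq> mons (2 * int d)"
    using assms by (intro keys_subset_mons) linarith
  then show ?thesis
    using real.peval_superset [of "mons (2 * int d)" p "($) x"]
    by (simp add: pairing_def moments_def evalp_monomial evalp_eq_peval [of p])
qed

lemma localizing_psd_moments:
  assumes "0 \<le> evalp p x"
  shows "localizing_psd d p (moments d x)"
proof -
  let ?B = "mons (int d - int (half_up (total_degree p)))" and ?e = "\<lambda>\<beta>. evalp (monomial \<beta>) x"
  have N: "Nmat d p (moments d x) \<beta> \<gamma> = evalp p x * ?e \<beta> * ?e \<gamma>" if "\<beta> \<in> ?B" "\<gamma> \<in> ?B" for \<beta> \<gamma>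
  proof -
    have "total_degree (p * monomial \<beta> * monomial \<gamma>) \<le> total_degree p + expo_degree \<beta> + expo_degree \<gamma>"
      by (intro total_degree_mult_le) auto
    also have "\<dots> \<le> 2 * d"
      using that half_up_bounds [of "total_degree p"] by (simp add: mons_def)
    finally show ?thesis by (simp add: Nmat_eq_pairing pairing_moments)
  qed
  have "(\<Sum>\<beta>\<in>?B. \<Sum>\<gamma>\<in>?B. v \<beta> * Nmat d p (moments d x) \<beta> \<gamma> * v \<gamma>)
      = evalp p x * (\<Sum>\<beta>\<in>?B. v \<beta> * ?e \<beta>)\<^sup>2" for v
  proof -
    have "(\<Sum>\<beta>\<in>?B. \<Sum>\<gamma>\<in>?B. v \<beta> * Nmat d p (moments d x) \<beta> \<gamma> * v \<gamma>)
        = (\<Sum>\<beta>\<in>?B. \<Sum>\<gamma>\<in>?B. evalp p x * ((v \<beta> * ?e \<beta>) * (v \<gamma> * ?e \<gamma>)))"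
      by (intro sum.cong refl) (simp add: N)
    then show ?thesis by (simp only: power2_eq_square sum_product) (simp only: sum_distrib_left)
  qed
  then have "0 \<le> (\<Sum>\<beta>\<in>?B. \<Sum>\<gamma>\<in>?B. v \<beta> * Nmat d p (moments d x) \<beta> \<gamma> * v \<gamma>)" for v
    using assms by simp
  moreover have "Nmat d p (moments d x) \<beta> \<gamma> = Nmat d p (moments d x) \<gamma> \<beta>" for \<beta> \<gamma>
    by (simp only: Nmat_eq_pairing mult_ac)
  ultimately show ?thesis
    unfolding localizing_psd_def psd_on_def by blast
qed

section \<open>Gradient inequalities\<close>

definition tangent :: "'n::finite mpoly \<Rightarrow> real ^ 'n \<Rightarrow> real ^ 'n \<Rightarrow> real" where
  "tangent h u x = evalp h u + (\<Sum>i\<in>UNIV. evalp (partial i h) u * (x $ i - u $ i))"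

lemma tangent_self [simp]: "tangent h u u = evalp h u"
  by (simp add: tangent_def)

lemma at_u_Rem:
  "at_u u (Rem h) = h - Const (evalp h u)
     - (\<Sum>i\<in>UNIV. Const (evalp (partial i h) u) * (Var i - Const (u $ i)))"
  by (simp add: Rem_def at_u_sum)

text \<open>
  The common form of \<open>qmod_repr\<close> (generators \<open>gen g i\<close> with \<open>i \<le> m\<close>) and \<open>pre_repr\<close> (generators
  \<open>gprod m g \<nu>\<close> with \<open>\<nu> \<in> cube m\<close>).
\<close>
definition sos_repr ::
  "'i set \<Rightarrow> ('i \<Rightarrow> 'n mpoly) \<Rightarrow> ('n + 'n) mpoly \<Rightarrow> ('i \<Rightarrow> 'i \<Rightarrow> ('n + 'n) mpoly) \<Rightarrow> bool" where
  "sos_repr I G r \<sigma> \<longleftrightarrow> (\<forall>i\<in>I. \<forall>j\<in>I. sos (\<sigma> i j)) \<and>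
     r = (\<Sum>i\<in>I. in_x (G i) * (\<Sum>j\<in>I. in_u (G j) * \<sigma> i j))"

lemma sos_repr_at_u:
  assumes "sos_repr I G r \<sigma>"
  shows "at_u u r = (\<Sum>i\<in>I. \<Sum>j\<in>I. Const (evalp (G j) u) * (G i * at_u u (\<sigma> i j)))"
proof -
  have "r = (\<Sum>i\<in>I. in_x (G i) * (\<Sum>j\<in>I. in_u (G j) * \<sigma> i j))"
    using assms by (simp add: sos_repr_def)
  then show ?thesis by (simp add: at_u_sum sum_distrib_left mult_ac)
qed

lemma sos_at_u: "sos \<sigma> \<Longrightarrow> sos (at_u u \<sigma>)"
proof -
  assume "sos \<sigma>"
  then obtain k :: nat and q where "\<sigma> = (\<Sum>l<k. (q l)\<^sup>2)" by (auto simp: sos_def)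
  then have "at_u u \<sigma> = (\<Sum>l<k. (at_u u (q l))\<^sup>2)" by (simp add: at_u_sum)
  then show ?thesis unfolding sos_def by (intro exI)
qed

lemma sos_nonneg: "sos \<sigma> \<Longrightarrow> 0 \<le> evalp \<sigma> x"
  by (auto simp: sos_def evalp_sum intro!: sum_nonneg)

text \<open>
  Jensen's inequality for a functional that need not come from a measure: apply \<open>\<Lambda>\<close> to the
  representation of \<open>- Rem h\<close> with \<open>u\<close> frozen. It is used for the functional of a lifted vector, and for
  evaluation at a point of the domain, where it says that \<open>h\<close> is concave there.
\<close>
lemma functional_le_tangent:
  fixes \<Lambda> :: "'n::finite mpoly \<Rightarrow> real"
  assumes add: "\<And>p q. \<Lambda> (p + q) = \<Lambda> p + \<Lambda> q" and scale: "\<And>a p. \<Lambda> (Const a * p) = a * \<Lambda> p"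
    and one: "\<Lambda> 1 = 1" and repr: "sos_repr I G (- Rem h) \<sigma>"
    and u: "\<And>j. j \<in> I \<Longrightarrow> 0 \<le> evalp (G j) u"
    and nonneg: "\<And>i j. i \<in> I \<Longrightarrow> j \<in> I \<Longrightarrow> 0 \<le> \<Lambda> (G i * at_u u (\<sigma> i j))"
  shows "\<Lambda> h \<le> tangent h u (\<chi> i. \<Lambda> (Var i))"
proof -
  have \<Lambda>0: "\<Lambda> 0 = 0" using add [of 0 0] by simp
  have \<Lambda>sum: "\<Lambda> (\<Sum>i\<in>A. P i) = (\<Sum>i\<in>A. \<Lambda> (P i))" for A :: "'z set" and P
    by (induction A rule: infinite_finite_induct) (auto simp: add \<Lambda>0)
  have \<Lambda>diff: "\<Lambda> (p - q) = \<Lambda> p - \<Lambda> q" for p q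
    using add [of "p - q" q] by simp
  have \<Lambda>Const: "\<Lambda> (Const a) = a" for a
    using scale [of a 1] one by simp
  have "0 \<le> \<Lambda> (at_u u (- Rem h))"
    unfolding sos_repr_at_u [OF repr]
    by (auto simp: \<Lambda>sum scale intro!: sum_nonneg mult_nonneg_nonneg u nonneg)
  also have "at_u u (- Rem h) = 0 - at_u u (Rem h)" by simp
  also have "\<Lambda> \<dots> = tangent h u (\<chi> i. \<Lambda> (Var i)) - \<Lambda> h"
    unfolding at_u_Rem by (simp add: \<Lambda>0 \<Lambda>diff \<Lambda>sum \<Lambda>Const scale tangent_def)
  finally show ?thesis by simp
qed

text \<open>
  With \<open>u\<close> frozen, \<open>h\<close> differs from \<open>Rem h\<close> by an affine polynomial. Hence the constraints have degree
  at most \<open>2 * d\<close>, and their localizing matrices are not void.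
\<close>
lemma total_degree_le_of_repr:
  fixes h :: "'n::finite mpoly"
  assumes repr: "sos_repr I G (- Rem h) \<sigma>" and "1 \<le> k"
    and deg: "\<And>i j. i \<in> I \<Longrightarrow> j \<in> I \<Longrightarrow> degree_x (in_x (G i) * \<sigma> i j) \<le> k"
  shows "total_degree h \<le> k"
proof -
  have "total_degree (at_u u (- Rem h)) \<le> k" for u
    unfolding sos_repr_at_u [OF repr]
  proof (intro total_degree_sum_le)
    fix i j assume "i \<in> I" "j \<in> I"
    then have "total_degree (G i * at_u u (\<sigma> i j)) \<le> k"
      using total_degree_at_u_le [of u "in_x (G i) * \<sigma> i j"] deg [of i j] by simp
    then show "total_degree (Const (evalp (G j) u) * (G i * at_u u (\<sigma> i j))) \<le> k"
      using total_degree_mult_le [of "Const (evalp (G j) u)" 0] by fastforce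
  qed
  moreover have "total_degree (\<Sum>i\<in>UNIV. Const (evalp (partial i h) 0) * (Var i - Const ((0 :: real ^ 'n) $ i))) \<le> k"
  proof (intro total_degree_sum_le)
    fix i
    have "total_degree (Var i - Const ((0 :: real ^ 'n) $ i)) \<le> k"
      using \<open>1 \<le> k\<close> by (intro total_degree_diff_le) auto
    then show "total_degree (Const (evalp (partial i h) 0) * (Var i - Const ((0 :: real ^ 'n) $ i))) \<le> k"
      using total_degree_mult_le [of "Const (evalp (partial i h) 0)" 0] by fastforce
  qed
  ultimately have "total_degree (Const (evalp h 0)
      + (\<Sum>i\<in>UNIV. Const (evalp (partial i h) 0) * (Var i - Const ((0 :: real ^ 'n) $ i)))
      - at_u 0 (- Rem h)) \<le> k"
    by (intro total_degree_diff_le total_degree_add_le) auto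
  then show ?thesis by (simp add: at_u_Rem)
qed

section \<open>Leaving a convex domain along a segment\<close>

lemma evalp_on_line:
  "\<exists>P :: real poly. \<forall>t. poly P t = evalp p (z + t *\<^sub>R v)"
proof (intro exI allI)
  fix t
  have "poly (peval (\<lambda>a. [:a:]) (\<lambda>i. [:z $ i, v $ i:]) p) t
      = peval (\<lambda>a. poly [:a:] t) (\<lambda>i. poly [:z $ i, v $ i:] t) p"
    by (rule hom_peval) auto
  also have "\<dots> = evalp p (z + t *\<^sub>R v)"
    unfolding evalp_eq_peval
    by (intro arg_cong2 [of _ _ _ _ "\<lambda>c s. peval c s p"]) (auto simp: fun_eq_iff)
  finally show "poly (peval (\<lambda>a. [:a:]) (\<lambda>i. [:z $ i, v $ i:]) p) t = evalp p (z + t *\<^sub>R v)" .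
qed

lemma continuous_on_evalp [continuous_intros]:
  "continuous_on A F \<Longrightarrow> continuous_on A (\<lambda>t. evalp p (F t))"
  unfolding evalp_def by (intro continuous_intros)

lemma closed_dom_set: "closed (dom_set m g)"
proof -
  have "dom_set m g = (\<Inter>i\<in>{1..m}. {x. 0 \<le> evalp (g i) x})"
    by (auto simp: dom_set_def)
  then show ?thesis
    by (simp only:) (intro closed_INT ballI closed_Collect_le continuous_intros)
qed

text \<open>
  The last point \<open>c T\<close> of the domain on the segment \<open>c\<close> from an interior point to \<open>b\<close> is not really the
  last: a constraint positive at \<open>c T\<close> stays so for a while, and one that vanishes there vanishes
  along the whole line.
\<close>
lemma mem_dom_set_of_tangents:
  assumes conv: "convex (dom_set m g)" and int: "interior (dom_set m g) \<noteq> {}"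
    and at: "\<And>i u. i \<in> {1..m} \<Longrightarrow> u \<in> dom_set m g \<Longrightarrow> 0 \<le> tangent (g i) u b"
    and concave: "\<And>i u x. i \<in> {1..m} \<Longrightarrow> u \<in> dom_set m g \<Longrightarrow> x \<in> dom_set m g \<Longrightarrow>
      evalp (g i) x \<le> tangent (g i) u x"
  shows "b \<in> dom_set m g"
proof (rule ccontr)
  assume b: "b \<notin> dom_set m g"
  let ?D = "dom_set m g"
  obtain z where z: "z \<in> interior ?D" using int by blast
  define v where "v = b - z"
  define c where "c = (\<lambda>t::real. z + t *\<^sub>R v)"
  have c_cont: "continuous_on A c" for A
    unfolding c_def by (intro continuous_intros)
  define A where "A = {0..1} \<inter> c -` ?D"
  have "compact A"
    unfolding A_def
    by (intro compact_Int_closed closed_vimage closed_dom_set c_cont compact_Icc)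
  moreover have "0 \<in> A" using z interior_subset by (auto simp: A_def c_def)
  ultimately obtain T where T: "T \<in> A" and T_max: "\<And>t. t \<in> A \<Longrightarrow> t \<le> T"
    using compact_attains_sup [of A] by blast
  have "T \<noteq> 1" using T b by (auto simp: A_def c_def v_def)
  then have T01: "0 \<le> T" "T < 1" using T by (auto simp: A_def)
  \<comment> \<open>This is where the interior is needed: for \<open>T = 0\<close> the interval \<open>{0..T}\<close> would be a single point.\<close>
  have "0 < T"
  proof -
    have "open (c -` interior ?D)" by (intro open_vimage c_cont) auto
    moreover have "0 \<in> c -` interior ?D" using z by (simp add: c_def)
    ultimately obtain e where e: "e > 0" "ball 0 e \<subseteq> c -` interior ?D"
      using open_contains_ball by blast
    have "min (e / 2) 1 \<in> ball 0 e" using e by auto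
    then have "c (min (e / 2) 1) \<in> ?D" using e interior_subset by blast
    then have "min (e / 2) 1 \<in> A" using e by (auto simp: A_def)
    from T_max [OF this] e show ?thesis by linarith
  qed
  have below: "c t \<in> ?D" if "0 \<le> t" "t \<le> T" for t
  proof -
    have "c t = (1 - t / T) *\<^sub>R c 0 + (t / T) *\<^sub>R c T"
      using \<open>0 < T\<close> by (simp add: c_def algebra_simps)
    moreover have "c 0 \<in> ?D" "c T \<in> ?D" using T \<open>0 \<in> A\<close> by (auto simp: A_def)
    ultimately show ?thesis
      using that \<open>0 < T\<close> convexD_alt [OF conv, of "c 0" "c T" "t / T"] by simp
  qed
  have cT: "c T \<in> ?D" using below T01 by simp
  have "eventually (\<lambda>t. 0 \<le> evalp (g i) (c t)) (at_right T)" if i: "i \<in> {1..m}" for i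
  proof (cases "evalp (g i) (c T) = 0")
    case False
    then have "0 < evalp (g i) (c T)" using cT i by (auto simp: dom_set_def less_le)
    moreover have "((\<lambda>t. evalp (g i) (c t)) \<longlongrightarrow> evalp (g i) (c T)) (at_right T)"
      using continuous_on_evalp [OF c_cont, of UNIV "g i"]
      by (auto simp: continuous_on_def intro: tendsto_within_subset)
    ultimately have "eventually (\<lambda>t. 0 < evalp (g i) (c t)) (at_right T)"
      by (intro order_tendstoD) auto
    then show ?thesis by eventually_elim simp
  next
    case True
    \<comment> \<open>the derivative of \<open>g i\<close> along the segment at \<open>c T\<close>\<close>
    define s where "s = (\<Sum>k\<in>UNIV. evalp (partial k (g i)) (c T) * v $ k)"
    have tangent_c: "tangent (g i) (c T) (c t) = (t - T) * s" for t
      using True by (simp add: tangent_def c_def s_def sum_distrib_left algebra_simps)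
    have "c 1 = b" by (simp add: c_def v_def)
    then have "0 \<le> (1 - T) * s" using at [OF i cT] tangent_c [of 1] by simp
    then have "0 \<le> s" using T01 by (simp add: zero_le_mult_iff)
    obtain P where P: "\<And>t. poly P t = evalp (g i) (c t)"
      using evalp_on_line [of "g i" z v] by (auto simp: c_def)
    have "poly P t = 0" if "t \<in> {0..T}" for t
    proof (rule antisym)
      have "poly P t \<le> (t - T) * s"
        using concave [OF i cT below, of t] that by (simp add: P tangent_c)
      also have "\<dots> \<le> 0" using that \<open>0 \<le> s\<close> by (simp add: mult_nonpos_nonneg)
      finally show "poly P t \<le> 0" .
      show "0 \<le> poly P t" using below [of t] that i by (simp add: P dom_set_def)
    qed
    then have "{0..T} \<subseteq> {t. poly P t = 0}" by blast
    moreover have "infinite {0..T}" using \<open>0 < T\<close> by simp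
    ultimately have "P = 0" using poly_roots_finite finite_subset by blast
    then show ?thesis using P by (metis (mono_tags, lifting) always_eventually order_refl poly_0)
  qed
  then have "eventually (\<lambda>t. \<forall>i\<in>{1..m}. 0 \<le> evalp (g i) (c t)) (at_right T)"
    by (intro eventually_ball_finite) auto
  moreover have "eventually (\<lambda>t. t \<in> {T<..<1}) (at_right T)"
    using T01 by (intro eventually_at_right_real) auto
  ultimately have "eventually (\<lambda>t. t \<in> A \<and> T < t) (at_right T)"
  proof eventually_elim
    case (elim t)
    then show ?case using T01 by (auto simp: A_def dom_set_def)
  qed
  then obtain t where "t \<in> A" "T < t"
    using eventually_happens trivial_limit_at_right_real by blast
  then show False using T_max by force
qed

section \<open>The projection of the lifted set\<close>

lemma sol_set_eq_projection:
  fixes f :: "'n::finite mpoly" and g :: "nat \<Rightarrow> 'n mpoly" and G :: "'i \<Rightarrow> 'n mpoly"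
  assumes conv: "convex (dom_set m g)" and int: "interior (dom_set m g) \<noteq> {}"
    and nonneg: "\<And>x i. x \<in> dom_set m g \<Longrightarrow> i \<in> I \<Longrightarrow> 0 \<le> evalp (G i) x"
    and contains: "g ` {1..m} \<subseteq> G ` I"
    and repr: "\<And>h. h \<in> insert f (g ` {1..m}) \<Longrightarrow> sos_repr I G (- Rem h) (\<sigma> h)"
    and deg: "\<And>h i j. h \<in> insert f (g ` {1..m}) \<Longrightarrow> i \<in> I \<Longrightarrow> j \<in> I \<Longrightarrow>
      degree_x (in_x (G i) * \<sigma> h i j) \<le> 2 * d"
    and d: "1 \<le> d"
  shows "sol_set m g f = proj ` {y \<in> mons (2 * int d) \<rightarrow>\<^sub>E UNIV.
     y 0 = 1 \<and> pairing d f y \<ge> 0 \<and> (\<forall>i\<in>I. localizing_psd d (G i) y)}" (is "_ = proj ` ?L")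
proof -
  have degree_le: "total_degree h \<le> 2 * d" if "h \<in> insert f (g ` {1..m})" for h
    using total_degree_le_of_repr [OF repr [OF that]] deg [OF that] d by simp
  have "x \<in> proj ` ?L" if x: "x \<in> sol_set m g f" for x
  proof -
    have in_L: "moments d x \<in> ?L"
    proof (intro CollectI conjI ballI)
      show "moments d x \<in> mons (2 * int d) \<rightarrow>\<^sub>E UNIV" by (auto simp: moments_def)
      show "moments d x 0 = 1" by (simp add: moments_def mons_def evalp_monomial)
      show "0 \<le> pairing d f (moments d x)"
        using x degree_le [of f] by (simp add: pairing_moments sol_set_def)
      show "localizing_psd d (G i) (moments d x)" if "i \<in> I" for i
        using x that nonneg by (intro localizing_psd_moments) (auto simp: sol_set_def)
    qed
    have "proj (moments d x) = x"
    proof (rule vec_eq_iff [THEN iffD2], rule allI)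
      fix i
      have "pairing d (Var i) (moments d x) = x $ i" using d by (subst pairing_moments) auto
      then show "proj (moments d x) $ i = x $ i"
        using d by (simp add: Var_def pairing_monomial proj_def)
    qed
    then show ?thesis using in_L by (rule image_eqI [OF sym])
  qed
  moreover have "b \<in> sol_set m g f" if bL: "b \<in> proj ` ?L" for b
  proof -
    from bL obtain y where b: "b = proj y" and yL: "y \<in> ?L" by (rule imageE)
    from yL have y: "y 0 = 1" "pairing d f y \<ge> 0" "\<And>i. i \<in> I \<Longrightarrow> localizing_psd d (G i) y"
      by simp_all
    have one: "pairing d 1 y = 1"
      using y(1) pairing_monomial [of 0 d y] by (simp add: monomial_def)
    have b_eq: "(\<chi> i. pairing d (Var i) y) = b"
      using d by (simp add: b proj_def Var_def pairing_monomial)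
    have below_tangent: "pairing d h y \<le> tangent h u b"
      if h: "h \<in> insert f (g ` {1..m})" and u: "u \<in> dom_set m g" for h u
    proof (rule functional_le_tangent [of "\<lambda>p. pairing d p y", unfolded b_eq,
          OF pairing_add pairing_scale one repr [OF h]])
      fix i j assume ij: "i \<in> I" "j \<in> I"
      have "total_degree (G i * at_u u (\<sigma> h i j)) \<le> 2 * d"
        using total_degree_at_u_le [of u "in_x (G i) * \<sigma> h i j"] deg [OF h ij] by simp
      then show "0 \<le> pairing d (G i * at_u u (\<sigma> h i j)) y"
        using y(3) repr [OF h] ij by (intro pairing_sos_nonneg sos_at_u) (auto simp: sos_repr_def)
    qed (rule nonneg [OF u])
    have "b \<in> dom_set m g"
    proof (rule mem_dom_set_of_tangents [OF conv int])
      fix k u assume k: "k \<in> {1..m}" and u: "u \<in> dom_set m g"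
      obtain i where i: "i \<in> I" "G i = g k" using contains k by (metis image_iff subsetD)
      \<comment> \<open>The localizing matrix of \<open>g k\<close> has the corner entry \<open>pairing d (g k) y\<close>.\<close>
      have "sos (1 :: 'n mpoly)" unfolding sos_def by (intro exI [of _ 1] exI [of _ "\<lambda>_. 1"]) simp
      then have "0 \<le> pairing d (g k) y"
        using pairing_sos_nonneg [OF y(3) [OF i(1)], of 1] i degree_le [of "g k"] k by simp
      then show "0 \<le> tangent (g k) u b"
        using below_tangent [of "g k" u] k u by simp
    next
      fix k u x assume k: "k \<in> {1..m}" and u: "u \<in> dom_set m g" and x: "x \<in> dom_set m g"
      have h: "g k \<in> insert f (g ` {1..m})" using k by simp
      have "evalp (g k) x \<le> tangent (g k) u (\<chi> i. evalp (Var i) x)"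
      proof (rule functional_le_tangent [where \<Lambda> = "\<lambda>p. evalp p x", OF _ _ _ repr [OF h]])
        fix i j assume ij: "i \<in> I" "j \<in> I"
        then have "0 \<le> evalp (at_u u (\<sigma> (g k) i j)) x"
          using repr [OF h] by (intro sos_nonneg sos_at_u) (simp add: sos_repr_def)
        then show "0 \<le> evalp (G i * at_u u (\<sigma> (g k) i j)) x"
          using nonneg [OF x ij(1)] by simp
      qed (use nonneg [OF u] in simp_all)
      then show "evalp (g k) x \<le> tangent (g k) u x" by simp
    qed
    moreover have "0 \<le> evalp f b"
      using y(2) below_tangent [OF _ calculation, of f] by simp
    ultimately show ?thesis by (simp add: sol_set_def)
  qed
  ultimately show ?thesis by (intro equalityI subsetI)
qed

lemma evalp_gprod_nonneg: "x \<in> dom_set m g \<Longrightarrow> 0 \<le> evalp (gprod m g \<nu>) x"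
  by (auto simp: gprod_def evalp_prod dom_set_def intro!: prod_nonneg)

lemma constraint_eq_gprod:
  assumes "k \<in> {1..m}"
  shows "\<exists>\<nu>\<in>cube m. gprod m g \<nu> = g k"
proof
  let ?\<nu> = "restrict (\<lambda>i. if i = k then 1 else 0) {1..m}"
  show "?\<nu> \<in> cube m" by (auto simp: cube_def)
  have "gprod m g ?\<nu> = (\<Prod>i=1..m. if i = k then g i else 1)"
    unfolding gprod_def by (intro prod.cong) auto
  then show "gprod m g ?\<nu> = g k" using assms by simp
qed

lemma degree_le_of_Max_half_up:
  assumes "finite A" "finite B" "finite C" "a \<in> A" "b \<in> B" "c \<in> C"
  shows "D a b c \<le> 2 * max 1 (Max {half_up (D a b c) | a b c. a \<in> A \<and> b \<in> B \<and> c \<in> C})"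
proof -
  let ?X = "{half_up (D a b c) | a b c. a \<in> A \<and> b \<in> B \<and> c \<in> C}"
  have "?X = (\<lambda>(a, b, c). half_up (D a b c)) ` (A \<times> B \<times> C)" by force
  then have "finite ?X" using assms by simp
  then have "half_up (D a b c) \<le> Max ?X" using assms by (intro Max_ge) auto
  then show ?thesis using half_up_bounds(1) [of "D a b c"] by linarith
qed

lemma finite_cube: "finite (cube m)"
  by (auto simp: cube_def intro: finite_PiE)

theorem theorem2p3:
  fixes f :: "'n::finite mpoly" and g :: "nat \<Rightarrow> 'n mpoly" and m :: nat
  assumes "convex (dom_set m g)" and "interior (dom_set m g) \<noteq> {}"
    and "convex (sol_set m g f)" and "interior (sol_set m g f) \<noteq> {}"
  shows
    "(qmod_concave m g f \<and> (\<forall>i\<in>{1..m}. qmod_concave m g (g i)) \<longrightarrow>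
       (\<forall>\<sigma>. (\<forall>h\<in>insert f (g ` {1..m}). qmod_repr m g (- Rem h) (\<sigma> h)) \<and>
            total_degree f \<le> 2 * d_qmod m g f \<sigma> \<longrightarrow>
            sol_set m g f = proj ` L_qmod m g (d_qmod m g f \<sigma>) f))
     \<and>
     (pre_concave m g f \<and> (\<forall>i\<in>{1..m}. pre_concave m g (g i)) \<longrightarrow>
       (\<forall>\<sigma>. (\<forall>h\<in>insert f (g ` {1..m}). pre_repr m g (- Rem h) (\<sigma> h)) \<and>
            total_degree f \<le> 2 * d_pre m g f \<sigma> \<longrightarrow>
            sol_set m g f = proj ` L_pre m g (d_pre m g f \<sigma>) f))"
proof (intro conjI impI allI)
  fix \<sigma> assume *: "(\<forall>h\<in>insert f (g ` {1..m}). qmod_repr m g (- Rem h) (\<sigma> h)) \<and>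
      total_degree f \<le> 2 * d_qmod m g f \<sigma>"
  let ?d = "d_qmod m g f \<sigma>"
  have "sol_set m g f = proj ` {y \<in> mons (2 * int ?d) \<rightarrow>\<^sub>E UNIV.
     y 0 = 1 \<and> pairing ?d f y \<ge> 0 \<and> (\<forall>i\<in>{..m}. localizing_psd ?d (gen g i) y)}"
  proof (rule sol_set_eq_projection [OF assms(1,2)])
    show "0 \<le> evalp (gen g i) x" if "x \<in> dom_set m g" "i \<in> {..m}" for x i
      using that by (auto simp: gen_def dom_set_def)
    show "g ` {1..m} \<subseteq> gen g ` {..m}" by (auto simp: gen_def image_iff intro!: bexI)
    show "sos_repr {..m} (gen g) (- Rem h) (\<sigma> h)" if "h \<in> insert f (g ` {1..m})" for h
      using * that by (auto simp: qmod_repr_def sos_repr_def)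
    show "degree_x (in_x (gen g i) * \<sigma> h i j) \<le> 2 * ?d"
      if "h \<in> insert f (g ` {1..m})" "i \<in> {..m}" "j \<in> {..m}" for h i j
      using that degree_le_of_Max_half_up [of "insert f (g ` {1..m})" "{..m}" "{..m}" h i j
          "\<lambda>h i j. degree_x (in_x (gen g i) * \<sigma> h i j)"]
      by (simp add: d_qmod_def)
    show "1 \<le> ?d" by (simp add: d_qmod_def)
  qed
  then show "sol_set m g f = proj ` L_qmod m g ?d f" by (simp only: L_qmod_def Ball_def atMost_iff)
next
  fix \<sigma> assume *: "(\<forall>h\<in>insert f (g ` {1..m}). pre_repr m g (- Rem h) (\<sigma> h)) \<and>
      total_degree f \<le> 2 * d_pre m g f \<sigma>"
  let ?d = "d_pre m g f \<sigma>"
  have "sol_set m g f = proj ` {y \<in> mons (2 * int ?d) \<rightarrow>\<^sub>E UNIV.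
     y 0 = 1 \<and> pairing ?d f y \<ge> 0 \<and> (\<forall>\<nu>\<in>cube m. localizing_psd ?d (gprod m g \<nu>) y)}"
  proof (rule sol_set_eq_projection [OF assms(1,2)])
    show "0 \<le> evalp (gprod m g \<nu>) x" if "x \<in> dom_set m g" for x \<nu>
      using that by (rule evalp_gprod_nonneg)
    show "g ` {1..m} \<subseteq> gprod m g ` cube m" using constraint_eq_gprod [of _ m g] by force
    show "sos_repr (cube m) (gprod m g) (- Rem h) (\<sigma> h)" if "h \<in> insert f (g ` {1..m})" for h
      using * that by (auto simp: pre_repr_def sos_repr_def)
    show "degree_x (in_x (gprod m g \<nu>) * \<sigma> h \<nu> \<mu>) \<le> 2 * ?d"
      if "h \<in> insert f (g ` {1..m})" "\<nu> \<in> cube m" "\<mu> \<in> cube m" for h \<nu> \<mu>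
      using that finite_cube [of m]
        degree_le_of_Max_half_up [of "insert f (g ` {1..m})" "cube m" "cube m" h \<nu> \<mu>
          "\<lambda>h \<nu> \<mu>. degree_x (in_x (gprod m g \<nu>) * \<sigma> h \<nu> \<mu>)"]
      by (simp add: d_pre_def)
    show "1 \<le> ?d" by (simp add: d_pre_def)
  qed
  then show "sol_set m g f = proj ` L_pre m g ?d f" by (simp only: L_pre_def)
qed

end
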